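(* Let $\nu$ be a non-negative Borel measure on $\Omega$ and let $h:\Omega\to\mathbb R_+$, $g:\Omega\to\mathbb R_+$ be two $\nu$-measurable functions. Then, for all $\lambda>0$ and all $k>0$, $$\nu\{h>\lambda\}\leq\frac1\lambda\int_{\{g\leq k\}}h\,d\nu+\nu\{g>k\}.$$
   Context: $\Omega$ is an open subset of $\mathbb R^n$; $\mathbb R_+=[0,+\infty)$; $\{h>\lambda\}=\{x\in\Omega:h(x)>\lambda\}$, and similarly for the other sets. *)

theory Defs
  imports "HOL-Analysis.Analysis"
begin

text \<open>
  Conventions. A non-negative Borel measure on an open set \<open>\<Omega>\<close> is a measure \<open>\<nu>\<close> (with values in
  \<open>[0, \<infinity>]\<close>, no finiteness assumed) whose sigma-algebra is that of the Borel subsets of \<open>\<Omega>\<close>. A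
  function is \<open>\<nu>\<close>-measurable if it is measurable for the \<open>\<nu>\<close>-completed sigma-algebra; this includes
  the Borel functions. Measures of sets and integrals are therefore taken with respect to
  \<open>completion \<nu>\<close>, which agrees with \<open>\<nu>\<close> on Borel sets and Borel functions.
\<close>

end

theory Submission
  imports Defs
begin

text \<open>
  The idea is to spend Markov's inequality only where \<open>g\<close> is small. A point of \<open>{h > l}\<close> either lies in
  \<open>{g > k}\<close>, whose measure is kept as it is, or in \<open>{h \<ge> l} \<inter> {g \<le> k}\<close>, whose measure Markov's
  inequality bounds by \<open>1 / l\<close> times the integral of \<open>h\<close> over \<open>{g \<le> k}\<close>. The argument works in any
  measure space, so it applies to the completed measure directly.
\<close>

lemma emeasure_superlevel_le_truncated_Markov:
  fixes h g :: "'a \<Rightarrow> real" and l k :: real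
  assumes [measurable]: "h \<in> borel_measurable M" "g \<in> borel_measurable M"
    and l: "l > 0"
  shows "emeasure M {x \<in> space M. h x > l}
    \<le> ennreal (1 / l) * (\<integral>\<^sup>+ x \<in> {x \<in> space M. g x \<le> k}. ennreal (h x) \<partial>M)
      + emeasure M {x \<in> space M. g x > k}"
proof -
  let ?A = "{x \<in> space M. g x \<le> k}"
  let ?B = "{x \<in> ?A. 1 \<le> ennreal (1 / l) * ennreal (h x)}"
  let ?C = "{x \<in> space M. g x > k}"
  have "1 \<le> ennreal (1 / l) * ennreal (h x)" if "h x > l" for x
    using that l by (simp flip: ennreal_mult ennreal_1 add: ennreal_le_iff)
  then have "{x \<in> space M. h x > l} \<subseteq> ?B \<union> ?C"
    by auto
  then have "emeasure M {x \<in> space M. h x > l} \<le> emeasure M (?B \<union> ?C)"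
    by (rule emeasure_mono) measurable
  also have "\<dots> \<le> emeasure M ?B + emeasure M ?C"
    by (rule emeasure_subadditive) measurable
  also have "emeasure M ?B \<le> ennreal (1 / l) * (\<integral>\<^sup>+ x \<in> ?A. ennreal (h x) \<partial>M)"
    by (rule nn_integral_Markov_inequality) measurable
  finally show ?thesis
    by (simp add: add_right_mono)
qed

theorem lemma3p1:
  fixes \<Omega> :: "(real ^ 'n) set"
    and \<nu> :: "(real ^ 'n) measure"
    and h g :: "real ^ 'n \<Rightarrow> real"
    and l k :: real
  assumes "open \<Omega>"
    and "sets \<nu> = sets (restrict_space borel \<Omega>)"
    and "h \<in> \<Omega> \<rightarrow> {0..}" and "g \<in> \<Omega> \<rightarrow> {0..}"
    and "h \<in> borel_measurable (completion \<nu>)"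
    and "g \<in> borel_measurable (completion \<nu>)"
    and "l > 0" and "k > 0"
  shows "emeasure (completion \<nu>) {x \<in> \<Omega>. h x > l}
    \<le> ennreal (1 / l) * (\<integral>\<^sup>+ x \<in> {x \<in> \<Omega>. g x \<le> k}. ennreal (h x) \<partial>completion \<nu>)
      + emeasure (completion \<nu>) {x \<in> \<Omega>. g x > k}"
proof -
  have "space (completion \<nu>) = \<Omega>"
    using sets_eq_imp_space_eq[OF assms(2)] by (simp add: space_restrict_space)
  then show ?thesis
    using emeasure_superlevel_le_truncated_Markov[OF assms(5,6,7), of k] by simp
qed

end
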